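(* Let $B\in M_n(\mathbb{R})$ be a similarity matrix with scaling factor $\rho>1$ and let $\mathcal{D}\subset\mathbb{R}^n$ be a finite set with $0\in\mathcal{D}$ and $\mathrm{card}(\mathcal{D})\le|\det B|$. Let $K=K(B,\mathcal{D})$ be the self-similar set determined by $(B,\mathcal{D})$, let $s=\log_\rho(\mathrm{card}(\mathcal{D}))$ be its similarity dimension, and let $\mu$ be the measure associated with $(B,\mathcal{D})$. Then $\mathcal{H}^s(K)=(\mathcal{E}_s^+(\mu))^{-1}$, with the convention that the right-hand side is $0$ if $\mathcal{E}_s^+(\mu)=\infty$.
   Context: $B$ is a similarity matrix with scaling factor $\rho>1$ if $B=\rho R$ with $R$ an orthogonal matrix. $K(B,\mathcal{D})$ is the unique non-empty compact set $K\subset\mathbb{R}^n$ with $BK=\bigcup_{d\in\mathcal{D}}(K+d)$. The measure $\mu$ is $$\mu=\lim_{N\to\infty}\sum_{\ell_0,\dots,\ell_{N-1}\in\mathcal{D}}\delta_{\ell_0+B\ell_1+\dots+B^{N-1}\ell_{N-1}},$$ where $\delta_x$ is the Dirac measure at $x$; points are counted with multiplicity (one for each tuple). Since $0\in\mathcal{D}$ the approximating measures are increasing in $N$, and $\mu$ is their setwise limit, with values in $[0,\infty]$. The upper $s$-density of a positive Borel measure $\mu$ on $\mathbb{R}^n$ is $$\mathcal{E}_s^+(\mu)=\limsup_{r\to\infty}\ \sup_{\mathrm{diam}(U)\ge r>0}\frac{\mu(U)}{[\mathrm{diam}(U)]^s},$$ where the supremum is over all compact convex sets $U\subset\mathbb{R}^n$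 with $\mathrm{diam}(U)\ge r$, and $\mathrm{diam}(U)=\sup\{\|x-y\|:x,y\in U\}$ (Euclidean norm). $\mathcal{H}^s$ is the Hausdorff measure without normalizing constant: $\mathcal{H}^s(E)=\lim_{\delta\to0}\mathcal{H}^s_\delta(E)$, where $\mathcal{H}^s_\delta(E)=\inf\{\sum_{i=1}^\infty[\mathrm{diam}(U_i)]^s: E\subseteq\bigcup_{i=1}^\infty U_i,\ \mathrm{diam}(U_i)<\delta\}$. *)

theory Defs
  imports "HOL-Probability.Probability"
begin

definition similarity_matrix :: "real \<Rightarrow> real^'n^'n \<Rightarrow> bool" where
  "similarity_matrix \<rho> B \<longleftrightarrow> (\<exists>R. orthogonal_matrix R \<and> B = \<rho> *\<^sub>R R)"

definition self_similar_set :: "real^'n^'n \<Rightarrow> (real^'n) set \<Rightarrow> (real^'n) set" where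
  "self_similar_set B D =
     (THE K. K \<noteq> {} \<and> compact K \<and> (\<lambda>x. B *v x) ` K = (\<Union>d\<in>D. (\<lambda>x. x + d) ` K))"

(* Matrix powers are written as iterates of the linear map, because the type-class
   multiplication on vectors of vectors is componentwise. *)
definition digit_expansion :: "real^'n^'n \<Rightarrow> nat \<Rightarrow> (nat \<Rightarrow> real^'n) \<Rightarrow> real^'n" where
  "digit_expansion B N l = (\<Sum>i<N. ((\<lambda>x. B *v x) ^^ i) (l i))"

(* The sum ranges over tuples, so points are counted with multiplicity. *)
definition digit_measure_approx :: "real^'n^'n \<Rightarrow> (real^'n) set \<Rightarrow> nat \<Rightarrow> (real^'n) measure" where
  "digit_measure_approx B D N =
     measure_of UNIV (sets borel)
       (\<lambda>A. \<Sum>l\<in>{..<N} \<rightarrow>\<^sub>E D. emeasure (return borel (digit_expansion B N l)) A)"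

definition digit_measure :: "real^'n^'n \<Rightarrow> (real^'n) set \<Rightarrow> (real^'n) measure" where
  "digit_measure B D =
     measure_of UNIV (sets borel) (\<lambda>A. lim (\<lambda>N. emeasure (digit_measure_approx B D N) A))"

definition upper_density :: "real \<Rightarrow> 'a::euclidean_space measure \<Rightarrow> ennreal" where
  "upper_density s M =
     Limsup at_top (\<lambda>r::real. SUP U\<in>{U. compact U \<and> convex U \<and> diameter U \<ge> r \<and> r > 0}.
       emeasure M U / ennreal (diameter U powr s))"

(* The s-th power of the diameter with the usual conventions for Hausdorff measures: the empty
   set contributes 0, and 0^0 = 1 for nonempty sets, so that s = 0 gives counting measure.
   A bare powr would give 0 powr 0 = 0. *)
definition diam_power :: "real \<Rightarrow> 'a::metric_space set \<Rightarrow> ennreal" where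
  "diam_power s U = (if U = {} then 0 else if s = 0 then 1 else ennreal (diameter U powr s))"

(* Boundedness is explicit since diameter is an unspecified real number on unbounded sets. *)
definition hausdorff_premeasure :: "real \<Rightarrow> real \<Rightarrow> 'a::metric_space set \<Rightarrow> ennreal" where
  "hausdorff_premeasure s \<delta> E =
     (INF U\<in>{U :: nat \<Rightarrow> 'a set. E \<subseteq> (\<Union>i. U i) \<and> (\<forall>i. bounded (U i) \<and> diameter (U i) < \<delta>)}.
       \<Sum>i. diam_power s (U i))"

definition hausdorff_measure :: "real \<Rightarrow> 'a::metric_space set \<Rightarrow> ennreal" where
  "hausdorff_measure s E = Lim (at_right 0) (\<lambda>\<delta>. hausdorff_premeasure s \<delta> E)"

end

theory Submission
  imports Defs
begin

text \<open>
  Write \<open>m = card D\<close>, so that \<open>\<rho> powr s = m\<close>, let \<open>K\<close> be the self-similar set and \<open>H\<close> its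
  Hausdorff measure. Iterating the defining equation, \<open>K\<close> is the union of \<open>m ^ N\<close> pieces
  \<open>B\<^sup>-\<^sup>N (K + e\<^sub>l)\<close>, where \<open>e\<^sub>l\<close> is the digit expansion of the tuple \<open>l\<close>. Copying a
  cover of \<open>K\<close> onto all pieces preserves the sum of the \<open>s\<close>-th powers of the diameters. Hence the
  premeasures of \<open>K\<close> agree for all size restrictions, and \<open>H\<close> may be computed with any of them
  (\<open>hausdorff_measure_attractor\<close>). Both inequalities then follow by comparing covers of \<open>K\<close>
  with counts of tuples. Neither a self-similar measure on \<open>K\<close> nor a separation condition on the
  pieces is involved.

  Upper bound for \<open>H\<close> (\<open>expansion_count_hausdorff_le\<close>): let \<open>U\<close> be bounded and let \<open>q\<close> of the
  \<open>m ^ N\<close> expansions lie in \<open>U\<close>. The Minkowski sum \<open>W = U + K\<close> contains \<open>K + e\<^sub>l\<close> for these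
  \<open>l\<close>, so \<open>K\<close> is covered by \<open>B\<^sup>-\<^sup>N W\<close> and the remaining \<open>m ^ N - q\<close> pieces. Therefore
  \<open>H \<le> m\<^sup>-\<^sup>N (diameter W) powr s + (m ^ N - q) m\<^sup>-\<^sup>N H\<close>, and since \<open>H\<close> is finite,
  \<open>q H \<le> (diameter U + diameter K) powr s\<close>. Letting \<open>N\<close> and then \<open>diameter U\<close> tend to infinity, the
  upper density is at most \<open>1 / H\<close>.

  Lower bound for \<open>H\<close> (\<open>density_bound_hausdorff\<close>): let \<open>C\<close> be finite and exceed the upper density, so that
  \<open>\<mu>(U) \<le> C (diameter U) powr s\<close> for compact convex \<open>U\<close> of large diameter. By fattening and
  compactness it is enough to consider finite covers of \<open>K\<close> by compact convex sets \<open>V\<^sub>i\<close> of positive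
  diameter. All \<open>m ^ N\<close> points \<open>B\<^sup>-\<^sup>N e\<^sub>l\<close> lie in \<open>K\<close>, hence in some \<open>V\<^sub>i\<close>, so that
  for large \<open>N\<close> the number \<open>m ^ N\<close> is at most the sum of the \<open>\<mu>(B\<^sup>N V\<^sub>i)\<close>, which is at most
  \<open>C m ^ N\<close> times the sum of the \<open>(diameter V\<^sub>i) powr s\<close>. Thus \<open>1 \<le> C H\<close>.
\<close>

section \<open>Inverses of extended nonnegative reals\<close>

lemma ennreal_inverse_inverse: "inverse (inverse x) = (x::ennreal)"
  using one_divide_one_divide_ennreal[of x] by (simp add: divide_ennreal_def)

lemma ennreal_le_inverse_iff:
  fixes x y :: ennreal
  shows "x \<le> inverse y \<longleftrightarrow> x * y \<le> 1"
proof (cases "y = 0 \<or> y = top")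
  case True
  then show ?thesis by (auto simp: ennreal_mult_top top_unique split: if_splits)
next
  case False
  then obtain b where b: "y = ennreal b" "b > 0"
    by (cases y) (auto simp: less_le)
  then show ?thesis
    by (cases x) (auto simp: inverse_ennreal ennreal_top_mult top_unique field_simps
        simp flip: ennreal_mult)
qed

lemma ennreal_le_inverse_commute:
  fixes x y :: ennreal
  shows "x \<le> inverse y \<longleftrightarrow> y \<le> inverse x"
  by (simp add: ennreal_le_inverse_iff mult.commute)

lemma ennreal_inverse_le_commute:
  fixes x y :: ennreal
  shows "inverse x \<le> y \<longleftrightarrow> inverse y \<le> x"
  using ennreal_le_inverse_commute[of "inverse x" "inverse y"]
  by (simp add: ennreal_inverse_inverse)

section \<open>Diameters\<close>

lemma diameter_convex_hull:
  fixes U :: "'a::real_normed_vector set"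
  assumes "bounded U"
  shows "diameter (convex hull U) = diameter U"
proof (rule antisym)
  let ?d = "diameter U"
  have U: "u \<in> cball v ?d" if "u \<in> U" "v \<in> U" for u v
    using diameter_bounded_bound[OF assms that(2,1)] by simp
  have hull_U: "x \<in> cball u ?d" if "x \<in> convex hull U" "u \<in> U" for x u
    using hull_minimal[of U "cball u ?d" convex] U that by (auto simp del: mem_cball)
  have "y \<in> cball x ?d" if "x \<in> convex hull U" "y \<in> convex hull U" for x y
  proof -
    have "U \<subseteq> cball x ?d"
      using hull_U[OF that(1)] by (auto simp: dist_commute)
    then show ?thesis
      using hull_minimal[of U "cball x ?d" convex] that(2) by auto
  qed
  then show "diameter (convex hull U) \<le> ?d"
    using diameter_ge_0[OF assms] by (intro diameter_le) (auto simp: dist_norm norm_minus_commute)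
  show "?d \<le> diameter (convex hull U)"
    by (intro diameter_subset hull_subset bounded_convex_hull assms)
qed

lemma diameter_sums_le:
  fixes U V :: "'a::real_normed_vector set"
  assumes "bounded U" "bounded V"
  shows "diameter {x + y |x y. x \<in> U \<and> y \<in> V} \<le> diameter U + diameter V"
proof (rule diameter_le)
  show "{x + y |x y. x \<in> U \<and> y \<in> V} \<noteq> {} \<or> 0 \<le> diameter U + diameter V"
    using assms by (simp add: diameter_ge_0)
next
  fix a b assume "a \<in> {x + y |x y. x \<in> U \<and> y \<in> V}" "b \<in> {x + y |x y. x \<in> U \<and> y \<in> V}"
  then obtain x y x' y' where ab: "a = x + y" "b = x' + y'" "x \<in> U" "x' \<in> U" "y \<in> V" "y' \<in> V"
    by auto
  have "norm (a - b) \<le> norm (x - x') + norm (y - y')"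
    unfolding ab by (metis add_diff_add norm_triangle_ineq)
  also have "\<dots> \<le> diameter U + diameter V"
    using diameter_bounded_bound[OF assms(1) ab(3,4)] diameter_bounded_bound[OF assms(2) ab(5,6)]
    by (simp add: dist_norm)
  finally show "norm (a - b) \<le> diameter U + diameter V" .
qed

lemma diameter_image_dilation:
  fixes g :: "'a::real_normed_vector \<Rightarrow> 'b::real_normed_vector"
  assumes g: "\<And>x y. dist (g x) (g y) = c * dist x y" and c: "c > 0" and U: "bounded U"
  shows "bounded (g ` U)" and "diameter (g ` U) = c * diameter U"
proof -
  obtain e where e: "dist x y \<le> e" if "x \<in> U" "y \<in> U" for x y
    using U unfolding bounded_two_points by blast
  then show bd: "bounded (g ` U)"
    unfolding bounded_two_points using c
    by (intro exI[of _ "c * e"]) (auto simp: g)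
  show "diameter (g ` U) = c * diameter U"
  proof (rule antisym)
    show "diameter (g ` U) \<le> c * diameter U"
      using c diameter_ge_0[OF U] diameter_bounded_bound[OF U]
      by (intro diameter_le) (auto simp: g simp flip: dist_norm)
    have "diameter U \<le> diameter (g ` U) / c"
      using c diameter_ge_0[OF bd] diameter_bounded_bound[OF bd imageI imageI]
      by (intro diameter_le) (auto simp: g field_simps simp flip: dist_norm)
    then show "c * diameter U \<le> diameter (g ` U)"
      using c by (simp add: field_simps)
  qed
qed

section \<open>Hausdorff premeasures\<close>

lemma diam_power_le:
  assumes "bounded U" "diameter U \<le> t" "0 < t" "0 \<le> s"
  shows "diam_power s U \<le> ennreal (t powr s)"
  using assms diameter_ge_0[OF assms(1)]
  by (auto simp: diam_power_def intro!: ennreal_leI powr_mono2)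

lemma diam_power_finite: "diam_power s U < top"
  by (simp add: diam_power_def)

lemma diam_power_image_dilation:
  fixes g :: "'a::real_normed_vector \<Rightarrow> 'b::real_normed_vector"
  assumes g: "\<And>x y. dist (g x) (g y) = c * dist x y" and c: "c > 0" and U: "bounded U"
  shows "diam_power s (g ` U) = ennreal (c powr s) * diam_power s U"
  using c diameter_ge_0[OF U] diameter_image_dilation[OF assms]
  by (auto simp: diam_power_def powr_mult simp flip: ennreal_mult)

lemma hausdorff_premeasure_le_cover:
  assumes "E \<subseteq> (\<Union>i. U i)" "\<And>i. bounded (U i)" "\<And>i. diameter (U i) < \<delta>"
  shows "hausdorff_premeasure s \<delta> E \<le> (\<Sum>i. diam_power s (U i))"
  unfolding hausdorff_premeasure_def using assms by (intro INF_lower) auto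

lemma hausdorff_premeasure_lessE:
  assumes "hausdorff_premeasure s \<delta> E < c"
  obtains U where "E \<subseteq> (\<Union>i. U i)" "\<And>i. bounded (U i)" "\<And>i. diameter (U i) < \<delta>"
    "(\<Sum>i. diam_power s (U i)) < c"
  using assms unfolding hausdorff_premeasure_def INF_less_iff by auto

lemma hausdorff_premeasure_mono:
  "E \<subseteq> F \<Longrightarrow> hausdorff_premeasure s \<delta> E \<le> hausdorff_premeasure s \<delta> F"
  unfolding hausdorff_premeasure_def by (rule INF_superset_mono) auto

lemma hausdorff_premeasure_antimono:
  "\<delta> \<le> \<delta>' \<Longrightarrow> hausdorff_premeasure s \<delta>' E \<le> hausdorff_premeasure s \<delta> E"
  unfolding hausdorff_premeasure_def by (rule INF_superset_mono) (blast intro: less_le_trans, simp)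

lemma hausdorff_premeasure_le_diam_power:
  assumes "bounded U" "diameter U < \<delta>"
  shows "hausdorff_premeasure s \<delta> U \<le> diam_power s U"
proof -
  let ?U = "\<lambda>i::nat. if i = 0 then U else {}"
  have "hausdorff_premeasure s \<delta> U \<le> (\<Sum>i. diam_power s (?U i))"
    using assms diameter_ge_0[OF assms(1)]
    by (intro hausdorff_premeasure_le_cover) (auto split: if_splits)
  also have "\<dots> = diam_power s U"
    by (subst suminf_finite[of "{0}"]) (auto simp: diam_power_def)
  finally show ?thesis .
qed

lemma hausdorff_premeasure_empty: "\<delta> > 0 \<Longrightarrow> hausdorff_premeasure s \<delta> {} = 0"
  using hausdorff_premeasure_le_diam_power[of "{}" \<delta> s] by (simp add: diam_power_def)

lemma less_add_ennreal:
  fixes x :: ennreal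
  assumes "x < top" "e > 0"
  shows "x < x + ennreal e"
  using assms by (cases x) (auto simp: ennreal_less_iff simp flip: ennreal_plus)

lemma suminf_interleave_ennreal:
  fixes f g :: "nat \<Rightarrow> ennreal"
  shows "(\<Sum>i. if even i then f (i div 2) else g (i div 2)) = suminf f + suminf g"
    (is "suminf ?h = _")
proof -
  have "sum ?h {..<2 * n} = sum f {..<n} + sum g {..<n}" for n
    by (induction n) (auto simp: ac_simps)
  moreover have "(\<lambda>n. sum ?h {..<2 * n}) \<longlonglongrightarrow> suminf ?h"
    using LIMSEQ_subseq_LIMSEQ[OF summable_LIMSEQ[OF summableI, of ?h], of "\<lambda>n. 2 * n"]
    by (simp add: strict_mono_def o_def)
  moreover have "(\<lambda>n. sum f {..<n} + sum g {..<n}) \<longlonglongrightarrow> suminf f + suminf g"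
    by (intro tendsto_add summable_LIMSEQ summableI)
  ultimately show ?thesis
    using LIMSEQ_unique by fastforce
qed

lemma hausdorff_premeasure_Un:
  "hausdorff_premeasure s \<delta> (A \<union> B) \<le> hausdorff_premeasure s \<delta> A + hausdorff_premeasure s \<delta> B"
proof (rule ennreal_le_epsilon)
  fix e :: real
  assume fin: "hausdorff_premeasure s \<delta> A + hausdorff_premeasure s \<delta> B < top" and e: "0 < e"
  have "hausdorff_premeasure s \<delta> E < hausdorff_premeasure s \<delta> E + ennreal (e / 2)"
    if "hausdorff_premeasure s \<delta> E < top" for E :: "'a set"
    using that e by (simp add: less_add_ennreal)
  then have "hausdorff_premeasure s \<delta> A < hausdorff_premeasure s \<delta> A + ennreal (e / 2)"
    "hausdorff_premeasure s \<delta> B < hausdorff_premeasure s \<delta> B + ennreal (e / 2)"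
    using fin by (auto simp: less_top)
  then obtain U V where
    U: "A \<subseteq> (\<Union>i. U i)" "\<And>i. bounded (U i)" "\<And>i. diameter (U i) < \<delta>"
      "(\<Sum>i. diam_power s (U i)) < hausdorff_premeasure s \<delta> A + ennreal (e / 2)" and
    V: "B \<subseteq> (\<Union>i. V i)" "\<And>i. bounded (V i)" "\<And>i. diameter (V i) < \<delta>"
      "(\<Sum>i. diam_power s (V i)) < hausdorff_premeasure s \<delta> B + ennreal (e / 2)"
    by (elim hausdorff_premeasure_lessE) blast
  let ?W = "\<lambda>i. if even i then U (i div 2) else V (i div 2)"
  have "x \<in> (\<Union>i. ?W i)" if x: "x \<in> A \<union> B" for x
  proof (cases "x \<in> A")
    case True
    then obtain i where "x \<in> ?W (2 * i)"
      using U(1) by auto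
    then show ?thesis by blast
  next
    case False
    then obtain i where "x \<in> ?W (2 * i + 1)"
      using V(1) x by auto
    then show ?thesis by blast
  qed
  then have "A \<union> B \<subseteq> (\<Union>i. ?W i)"
    by (rule subsetI)
  moreover have "bounded (?W i)" "diameter (?W i) < \<delta>" for i
    using U V by auto
  ultimately have "hausdorff_premeasure s \<delta> (A \<union> B) \<le> (\<Sum>i. diam_power s (?W i))"
    by (rule hausdorff_premeasure_le_cover)
  also have "\<dots> = (\<Sum>i. if even i then diam_power s (U (i div 2)) else diam_power s (V (i div 2)))"
    by (intro suminf_cong) auto
  also have "\<dots> = (\<Sum>i. diam_power s (U i)) + (\<Sum>i. diam_power s (V i))"
    by (rule suminf_interleave_ennreal)
  also have "\<dots> \<le> (hausdorff_premeasure s \<delta> A + ennreal (e / 2)) +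
      (hausdorff_premeasure s \<delta> B + ennreal (e / 2))"
    using U(4) V(4) by (intro add_mono) auto
  also have "\<dots> = hausdorff_premeasure s \<delta> A + hausdorff_premeasure s \<delta> B +
      (ennreal (e / 2) + ennreal (e / 2))"
    by (simp add: ac_simps)
  also have "ennreal (e / 2) + ennreal (e / 2) = ennreal e"
    using e by (simp flip: ennreal_plus)
  finally show "hausdorff_premeasure s \<delta> (A \<union> B) \<le>
      hausdorff_premeasure s \<delta> A + hausdorff_premeasure s \<delta> B + ennreal e" .
qed

lemma hausdorff_premeasure_UN:
  assumes "\<delta> > 0" "finite I"
  shows "hausdorff_premeasure s \<delta> (\<Union>i\<in>I. A i) \<le> (\<Sum>i\<in>I. hausdorff_premeasure s \<delta> (A i))"
  using assms(2)
proof induction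
  case empty
  then show ?case using assms(1) by (simp add: hausdorff_premeasure_empty)
next
  case (insert i I)
  then show ?case
    by (auto intro: order_trans[OF hausdorff_premeasure_Un] add_left_mono)
qed

lemma hausdorff_premeasure_image_dilation:
  fixes g :: "'a::real_normed_vector \<Rightarrow> 'b::real_normed_vector"
  assumes g: "\<And>x y. dist (g x) (g y) = c * dist x y" and c: "c > 0"
  shows "hausdorff_premeasure s (c * \<delta>) (g ` E) \<le> ennreal (c powr s) * hausdorff_premeasure s \<delta> E"
proof (rule ennreal_le_epsilon)
  fix e :: real
  assume fin: "ennreal (c powr s) * hausdorff_premeasure s \<delta> E < top" and e: "0 < e"
  have "hausdorff_premeasure s \<delta> E < top"
    using fin c by (auto simp: ennreal_mult_less_top)
  then have "hausdorff_premeasure s \<delta> E < hausdorff_premeasure s \<delta> E + ennreal (e / c powr s)"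
    using e c by (simp add: less_add_ennreal)
  then obtain U where
    U: "E \<subseteq> (\<Union>i. U i)" "\<And>i. bounded (U i)" "\<And>i. diameter (U i) < \<delta>"
      "(\<Sum>i. diam_power s (U i)) < hausdorff_premeasure s \<delta> E + ennreal (e / c powr s)"
    by (elim hausdorff_premeasure_lessE) blast
  have "g ` E \<subseteq> (\<Union>i. g ` U i)"
    using U(1) by blast
  then have "hausdorff_premeasure s (c * \<delta>) (g ` E) \<le> (\<Sum>i. diam_power s (g ` U i))"
    using U diameter_image_dilation[OF g c U(2)] c
    by (intro hausdorff_premeasure_le_cover) auto
  also have "\<dots> = ennreal (c powr s) * (\<Sum>i. diam_power s (U i))"
    by (simp add: diam_power_image_dilation[OF g c U(2)])
  also have "\<dots> \<le> ennreal (c powr s) * (hausdorff_premeasure s \<delta> E + ennreal (e / c powr s))"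
    using U(4) by (intro mult_left_mono) auto
  also have "\<dots> = ennreal (c powr s) * hausdorff_premeasure s \<delta> E + ennreal e"
    using c e by (simp add: distrib_left flip: ennreal_mult)
  finally show "hausdorff_premeasure s (c * \<delta>) (g ` E) \<le>
      ennreal (c powr s) * hausdorff_premeasure s \<delta> E + ennreal e" .
qed

section \<open>Digit expansions of a similarity\<close>

lemma closure_finite_UN: "finite I \<Longrightarrow> closure (\<Union>i\<in>I. A i) = (\<Union>i\<in>I. closure (A i))"
  by (induction rule: finite_induct) auto

text \<open>The setting without the matrix entries: all that is used of \<open>B\<close> is that it multiplies
  every norm by \<open>\<rho>\<close>.\<close>

locale similarity_digits =
  fixes B :: "real^'n^'n" and D :: "(real^'n) set" and \<rho> :: real
  assumes rho: "\<rho> > 1"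
    and norm_matrix: "\<And>x. norm (B *v x) = \<rho> * norm x"
    and finite_digits: "finite D"
    and zero_digit: "0 \<in> D"
begin

text \<open>The power \<open>B\<^sup>N\<close> as a map. Its inverse is written \<open>inv (scale N)\<close>.\<close>

abbreviation scale :: "nat \<Rightarrow> real^'n \<Rightarrow> real^'n" where
  "scale N \<equiv> (\<lambda>x. B *v x) ^^ N"

abbreviation digits :: "nat \<Rightarrow> (nat \<Rightarrow> real^'n) set" where
  "digits N \<equiv> {..<N} \<rightarrow>\<^sub>E D"

lemma linear_scale: "linear (scale N)"
proof (induction N)
  case (Suc N)
  then show ?case
    unfolding funpow.simps(2) by (rule linear_compose[OF _ matrix_vector_mul_linear])
qed (simp add: linear_id id_def[symmetric])

lemmas scale_add = linear_add[OF linear_scale]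
  and scale_zero = linear_0[OF linear_scale]

lemma norm_scale: "norm (scale N x) = \<rho> ^ N * norm x"
  by (induction N) (auto simp: norm_matrix)

lemma dist_scale: "dist (scale N x) (scale N y) = \<rho> ^ N * dist x y"
  by (simp add: dist_norm norm_scale flip: linear_diff[OF linear_scale])

lemma inj_scale: "inj (scale N)"
proof (rule injI)
  fix x y assume "scale N x = scale N y"
  then have "\<rho> ^ N * dist x y = 0"
    using dist_scale[of N x y] by simp
  then show "x = y" using rho by simp
qed

lemma surj_scale: "surj (scale N)"
  using linear_injective_imp_surjective[OF linear_scale inj_scale] by blast

lemma dist_inv_scale: "dist (inv (scale N) x) (inv (scale N) y) = (1 / \<rho> ^ N) * dist x y"
  using dist_scale[of N "inv (scale N) x" "inv (scale N) y"] rho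
  by (simp add: surj_f_inv_f[OF surj_scale] field_simps)

lemma finite_tuples: "finite (digits N)"
  by (intro finite_PiE finite_digits) auto

lemma card_tuples: "card (digits N) = card D ^ N"
  by (simp add: card_PiE)

text \<open>A tuple of length \<open>Suc N\<close> is a tuple of length \<open>N\<close> together with a most significant
  digit \<open>d\<close>, which contributes \<open>B\<^sup>N d\<close> to the expansion.\<close>

lemma digit_expansion_upd:
  "digit_expansion B (Suc N) (l(N := d)) = digit_expansion B N l + scale N d"
  by (simp add: digit_expansion_def)

lemma tuples_Suc: "digits (Suc N) = (\<lambda>(d, l). l(N := d)) ` (D \<times> digits N)"
  by (simp add: lessThan_Suc PiE_insert_eq)

lemma UN_tuples_Suc: "(\<Union>l\<in>digits (Suc N). F l) = (\<Union>d\<in>D. \<Union>l\<in>digits N. F (l(N := d)))"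
  unfolding tuples_Suc by (simp add: set_eq_iff split_paired_Bex_Sigma)

lemma sum_tuples_Suc:
  fixes g :: "real^'n \<Rightarrow> 'b::comm_monoid_add"
  shows "(\<Sum>l\<in>digits (Suc N). g (digit_expansion B (Suc N) l)) =
    (\<Sum>d\<in>D. \<Sum>l\<in>digits N. g (digit_expansion B N l + scale N d))"
proof -
  have "inj_on (\<lambda>(d, l). l(N := d)) (D \<times> digits N)"
    using inj_combinator[of N "{..<N}" "\<lambda>_. D"] by simp
  from sum.reindex[OF this, of "\<lambda>l. g (digit_expansion B (Suc N) l)"] show ?thesis
    unfolding tuples_Suc sum.cartesian_product
    by (simp only: o_def split_beta' digit_expansion_upd)
qed

section \<open>Existence and uniqueness of the self-similar set\<close>

text \<open>The points \<open>B\<^sup>-\<^sup>N (l\<^sub>0 + B l\<^sub>1 + \<dots> + B\<^sup>N\<^sup>-\<^sup>1 l\<^sub>N\<^sub>-\<^sub>1)\<close> for all \<open>N\<close>, that is, the finite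
  expansions with digits after the radix point.\<close>

definition scaled_expansions :: "(real^'n) set" where
  "scaled_expansions = (\<Union>N. (\<lambda>l. inv (scale N) (digit_expansion B N l)) ` digits N)"

text \<open>The self-similar set, constructed as a closure. No limit of iterated images is needed: as
  zero is a digit, the finite expansions already satisfy the defining equation, and this passes to
  the closure because finitely many digits occur.\<close>

definition attractor :: "(real^'n) set" where
  "attractor = closure scaled_expansions"

lemma scaled_expansions_iff:
  "x \<in> scaled_expansions \<longleftrightarrow> (\<exists>N. \<exists>l\<in>digits N. scale N x = digit_expansion B N l)"
proof -
  have "x = inv (scale N) y \<longleftrightarrow> scale N x = y" for N and y :: "real^'n"
    using surj_f_inv_f[OF surj_scale, of N y] inv_f_f[OF inj_scale, of N x] by auto
  then show ?thesis
    unfolding scaled_expansions_def by auto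
qed

lemma scale_comm: "scale N (B *v x) = B *v scale N x"
  by (metis comp_apply funpow_Suc_right funpow.simps(2))

lemma image_scaled_expansions:
  "(\<lambda>x. B *v x) ` scaled_expansions = (\<Union>d\<in>D. (\<lambda>x. x + d) ` scaled_expansions)"
proof (intro equalityI subsetI)
  fix y assume "y \<in> (\<lambda>x. B *v x) ` scaled_expansions"
  then obtain x N l where y: "y = B *v x" and l: "l \<in> digits N" "scale N x = digit_expansion B N l"
    by (auto simp: scaled_expansions_iff)
  show "y \<in> (\<Union>d\<in>D. (\<lambda>x. x + d) ` scaled_expansions)"
  proof (cases N)
    case 0
    then have "x = 0" using l by (simp add: digit_expansion_def)
    then have "y = 0 + 0" "0 \<in> scaled_expansions"
      using y by (auto simp: scaled_expansions_iff digit_expansion_def intro!: exI[of _ 0])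
    then show ?thesis using zero_digit by blast
  next
    case (Suc M)
    then obtain d l' where d: "d \<in> D" "l' \<in> digits M" "l = l'(M := d)"
      using l(1) unfolding Suc tuples_Suc by auto
    have "scale M y = digit_expansion B M l' + scale M d"
      using l(2) d unfolding y Suc by (simp add: digit_expansion_upd scale_comm)
    then have "scale M (y - d) = digit_expansion B M l'"
      by (simp add: linear_diff[OF linear_scale])
    then have "y - d \<in> scaled_expansions"
      using d by (auto simp: scaled_expansions_iff)
    then have "(y - d) + d \<in> (\<lambda>x. x + d) ` scaled_expansions"
      by blast
    then show ?thesis using d(1) by auto
  qed
next
  fix y assume "y \<in> (\<Union>d\<in>D. (\<lambda>x. x + d) ` scaled_expansions)"
  then obtain d x N l where d: "d \<in> D" "y = x + d" "l \<in> digits N"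
    "scale N x = digit_expansion B N l"
    by (auto simp: scaled_expansions_iff)
  obtain z where z: "y = B *v z"
    using surjD[OF surj_scale[of 1], of y] by auto
  have "scale (Suc N) z = digit_expansion B (Suc N) (l(N := d))"
    using d by (simp add: digit_expansion_upd scale_add flip: scale_comm z)
  moreover have "l(N := d) \<in> digits (Suc N)"
    unfolding tuples_Suc using d by auto
  ultimately have "z \<in> scaled_expansions"
    unfolding scaled_expansions_iff by blast
  then show "y \<in> (\<lambda>x. B *v x) ` scaled_expansions"
    using z by blast
qed

lemma bounded_scaled_expansions: "bounded scaled_expansions"
proof -
  obtain c where c: "\<And>d. d \<in> D \<Longrightarrow> norm d \<le> c"
    using finite_imp_bounded[OF finite_digits] unfolding bounded_iff by blast
  have c0: "c \<ge> 0" using c[OF zero_digit] by simp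
  \<comment> \<open>The bound is \<open>c\<close> times a geometric sum, with \<open>\<rho>\<^sup>N - 1\<close> enlarged to \<open>\<rho>\<^sup>N\<close>.\<close>
  have bnd: "norm (digit_expansion B N l) \<le> (c / (\<rho> - 1)) * \<rho> ^ N" if "l \<in> digits N" for N l
    using that
  proof (induction N arbitrary: l)
    case 0
    then show ?case using c0 rho by (simp add: digit_expansion_def)
  next
    case (Suc N)
    then obtain d l' where d: "d \<in> D" "l' \<in> digits N" "l = l'(N := d)"
      unfolding tuples_Suc by auto
    have "norm (digit_expansion B (Suc N) l) \<le> norm (digit_expansion B N l') + \<rho> ^ N * norm d"
      unfolding d(3) digit_expansion_upd by (metis norm_scale norm_triangle_ineq)
    also have "\<dots> \<le> (c / (\<rho> - 1)) * \<rho> ^ N + \<rho> ^ N * c"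
      using Suc.IH[OF d(2)] c[OF d(1)] rho by (intro add_mono mult_left_mono) auto
    also have "\<dots> = (c / (\<rho> - 1)) * \<rho> ^ Suc N"
      using rho by (simp add: field_simps)
    finally show ?case .
  qed
  have "norm x \<le> c / (\<rho> - 1)" if "x \<in> scaled_expansions" for x
  proof -
    obtain N l where "l \<in> digits N" "scale N x = digit_expansion B N l"
      using \<open>x \<in> scaled_expansions\<close> by (auto simp: scaled_expansions_iff)
    then have "\<rho> ^ N * norm x \<le> \<rho> ^ N * (c / (\<rho> - 1))"
      using bnd[of l N] by (metis mult.commute norm_scale)
    then show ?thesis using rho by (simp del: times_divide_eq_right)
  qed
  then show ?thesis unfolding bounded_iff by blast
qed

lemma compact_attractor: "compact attractor"
  unfolding attractor_def using bounded_scaled_expansions by (simp add: compact_closure)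

lemma scaled_expansions_attractor: "scaled_expansions \<subseteq> attractor"
  unfolding attractor_def by (rule closure_subset)

lemma attractor_nonempty: "attractor \<noteq> {}"
proof -
  have "0 \<in> scaled_expansions"
    by (auto simp: scaled_expansions_iff digit_expansion_def intro!: exI[of _ 0])
  then show ?thesis using scaled_expansions_attractor by blast
qed

lemma image_attractor:
  "(\<lambda>x. B *v x) ` attractor = (\<Union>d\<in>D. (\<lambda>x. x + d) ` attractor)"
proof -
  have "(\<lambda>x. B *v x) ` attractor = closure ((\<lambda>x. B *v x) ` scaled_expansions)"
    unfolding attractor_def using inj_scale[of 1] linear_scale[of 1]
    by (intro closure_injective_linear_image) auto
  also have "\<dots> = (\<Union>d\<in>D. closure ((\<lambda>x. x + d) ` scaled_expansions))"
    unfolding image_scaled_expansions by (rule closure_finite_UN[OF finite_digits])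
  also have "\<dots> = (\<Union>d\<in>D. (\<lambda>x. x + d) ` attractor)"
    using closure_translation[of _ scaled_expansions] by (simp add: attractor_def add.commute)
  finally show ?thesis .
qed

text \<open>The largest distance from a point of one solution to the other is at most \<open>1 / \<rho>\<close> times
  itself, hence zero.\<close>

lemma self_similar_subset:
  assumes K: "K \<noteq> {}" "compact K" "(\<lambda>x. B *v x) ` K = (\<Union>d\<in>D. (\<lambda>x. x + d) ` K)"
    and L: "L \<noteq> {}" "compact L" "(\<lambda>x. B *v x) ` L = (\<Union>d\<in>D. (\<lambda>x. x + d) ` L)"
  shows "K \<subseteq> L"
proof -
  obtain x where x: "x \<in> K" "\<And>y. y \<in> K \<Longrightarrow> infdist y L \<le> infdist x L"
    using continuous_attains_sup[OF K(2,1) continuous_on_infdist[OF continuous_on_id], of L]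
    by blast
  have "B *v x \<in> (\<Union>d\<in>D. (\<lambda>x. x + d) ` K)"
    using x(1) K(3) by blast
  then obtain k d where k: "k \<in> K" "d \<in> D" "B *v x = k + d"
    by auto
  obtain k' where k': "k' \<in> L" "infdist k L = dist k k'"
    using infdist_attains_inf[OF compact_imp_closed[OF L(2)] L(1)] by blast
  have "k' + d \<in> (\<lambda>x. B *v x) ` L"
    using k'(1) k(2) unfolding L(3) by blast
  then obtain z where z: "z \<in> L" "B *v z = k' + d"
    by (metis imageE)
  have "\<rho> * infdist x L \<le> \<rho> * dist x z"
    using infdist_le[OF z(1)] rho by simp
  also have "\<dots> = dist k k'"
    using dist_scale[of 1 x z] k(3) z(2) by simp
  also have "\<dots> \<le> infdist x L"
    using x(2)[OF k(1)] k'(2) by simp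
  finally have "(\<rho> - 1) * infdist x L \<le> 0"
    by (simp add: algebra_simps)
  then have "infdist x L \<le> 0"
    using rho by (simp add: mult_le_0_iff)
  then have "infdist y L = 0" if "y \<in> K" for y
    using x(2)[OF that] infdist_nonneg[of y L] by linarith
  then show ?thesis
    using in_closed_iff_infdist_zero[OF compact_imp_closed[OF L(2)] L(1)] by blast
qed

lemma self_similar_set_eq: "self_similar_set B D = attractor"
  unfolding self_similar_set_def
proof (rule the_equality)
  show "attractor \<noteq> {} \<and> compact attractor \<and>
      (\<lambda>x. B *v x) ` attractor = (\<Union>d\<in>D. (\<lambda>x. x + d) ` attractor)"
    using attractor_nonempty compact_attractor image_attractor by blast
next
  show "K = attractor" if "K \<noteq> {} \<and> compact K \<and>
      (\<lambda>x. B *v x) ` K = (\<Union>d\<in>D. (\<lambda>x. x + d) ` K)" for K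
  proof (rule subset_antisym)
    note attr = attractor_nonempty compact_attractor image_attractor
    note K = that[THEN conjunct1] that[THEN conjunct2, THEN conjunct1]
      that[THEN conjunct2, THEN conjunct2]
    show "K \<subseteq> attractor" by (rule self_similar_subset[OF K attr])
    show "attractor \<subseteq> K" by (rule self_similar_subset[OF attr K])
  qed
qed

lemma scale_attractor:
  "scale N ` attractor = (\<Union>l\<in>digits N. (\<lambda>x. x + digit_expansion B N l) ` attractor)"
proof (induction N)
  case 0
  then show ?case by (simp add: digit_expansion_def)
next
  case (Suc N)
  have "scale (Suc N) ` attractor = scale N ` (\<lambda>x. B *v x) ` attractor"
    by (simp add: image_image scale_comm)
  also have "\<dots> = (\<Union>d\<in>D. (\<lambda>x. x + scale N d) ` scale N ` attractor)"
    unfolding image_attractor by (simp add: image_UN image_image scale_add)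
  also have "\<dots> = (\<Union>d\<in>D. \<Union>l\<in>digits N.
      (\<lambda>x. x + digit_expansion B (Suc N) (l(N := d))) ` attractor)"
    unfolding Suc.IH by (simp add: image_UN image_image digit_expansion_upd add.assoc)
  also have "\<dots> = (\<Union>l\<in>digits (Suc N). (\<lambda>x. x + digit_expansion B (Suc N) l) ` attractor)"
    by (simp add: UN_tuples_Suc)
  finally show ?case .
qed

section \<open>The counting measure of digit expansions\<close>

text \<open>The number of tuples of length \<open>N\<close> whose expansion lies in \<open>A\<close>, with values in the
  extended nonnegative reals so that it can be compared with the limit measure.\<close>

definition expansion_count :: "nat \<Rightarrow> (real^'n) set \<Rightarrow> ennreal" where
  "expansion_count N A = (\<Sum>l\<in>digits N. indicator A (digit_expansion B N l))"

lemma emeasure_digit_measure_approx: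
  assumes "A \<in> sets borel"
  shows "emeasure (digit_measure_approx B D N) A = expansion_count N A"
proof -
  let ?f = "\<lambda>A. \<Sum>l\<in>digits N. emeasure (return borel (digit_expansion B N l)) A"
  have "countably_additive (sets borel) ?f"
  proof (rule countably_additiveI)
    fix A :: "nat \<Rightarrow> (real^'n) set"
    assume A: "range A \<subseteq> sets borel" "disjoint_family A"
    have "(\<Sum>i. ?f (A i)) = (\<Sum>l\<in>digits N. \<Sum>i. emeasure (return borel (digit_expansion B N l)) (A i))"
      by (rule suminf_sum) simp
    also have "\<dots> = ?f (\<Union>i. A i)"
      using A by (intro sum.cong suminf_emeasure) auto
    finally show "(\<Sum>i. ?f (A i)) = ?f (\<Union>i. A i)" .
  qed
  moreover have "positive (sets borel) ?f"
    by (simp add: positive_def)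
  moreover have "sigma_algebra UNIV (sets (borel :: (real^'n) measure))"
    using sets.sigma_algebra_axioms[of "borel :: (real^'n) measure"] by simp
  ultimately have "emeasure (digit_measure_approx B D N) A = ?f A"
    unfolding digit_measure_approx_def using assms by (intro emeasure_measure_of_sigma)
  then show ?thesis
    using assms by (simp add: expansion_count_def emeasure_return)
qed

text \<open>Padding a tuple with the digit zero does not change its expansion.\<close>

lemma incseq_expansion_count: "incseq (\<lambda>N. expansion_count N A)"
proof (rule incseq_SucI)
  fix N
  have "expansion_count N A = (\<Sum>d\<in>{0}. \<Sum>l\<in>digits N. indicator A (digit_expansion B N l + scale N d))"
    by (simp add: expansion_count_def scale_zero)
  also have "\<dots> \<le> (\<Sum>d\<in>D. \<Sum>l\<in>digits N. indicator A (digit_expansion B N l + scale N d))"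
    using zero_digit finite_digits by (intro sum_mono2) auto
  also have "\<dots> = expansion_count (Suc N) A"
    by (simp add: expansion_count_def sum_tuples_Suc)
  finally show "expansion_count N A \<le> expansion_count (Suc N) A" .
qed

lemma emeasure_digit_measure:
  assumes "A \<in> sets borel"
  shows "emeasure (digit_measure B D) A = (SUP N. expansion_count N A)"
proof -
  let ?f = "\<lambda>A. lim (\<lambda>N. emeasure (digit_measure_approx B D N) A)"
  have f: "?f A = (SUP N. expansion_count N A)" if "A \<in> sets borel" for A
    unfolding emeasure_digit_measure_approx[OF that]
    by (rule limI[OF LIMSEQ_SUP[OF incseq_expansion_count]])
  have "countably_additive (sets borel) ?f"
  proof (rule countably_additiveI)
    fix A :: "nat \<Rightarrow> (real^'n) set"
    assume A: "range A \<subseteq> sets borel" "disjoint_family A" "(\<Union>i. A i) \<in> sets borel"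
    have "(\<Sum>i. ?f (A i)) = (\<Sum>i. SUP N. expansion_count N (A i))"
      using A(1) by (intro suminf_cong f) auto
    also have "\<dots> = (SUP N. \<Sum>i. expansion_count N (A i))"
      by (rule ennreal_suminf_SUP_eq[OF incseq_expansion_count])
    also have "(\<lambda>N. \<Sum>i. expansion_count N (A i)) = (\<lambda>N. expansion_count N (\<Union>i. A i))"
    proof
      fix N
      have "(\<Sum>i. emeasure (digit_measure_approx B D N) (A i)) =
          emeasure (digit_measure_approx B D N) (\<Union>i. A i)"
        using A(1,2) by (intro suminf_emeasure) (auto simp: digit_measure_approx_def)
      then show "(\<Sum>i. expansion_count N (A i)) = expansion_count N (\<Union>i. A i)"
        using A(1,3) by (simp add: emeasure_digit_measure_approx range_subsetD)
    qed
    finally show "(\<Sum>i. ?f (A i)) = ?f (\<Union>i. A i)"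
      by (simp add: f[OF A(3)])
  qed
  moreover have "positive (sets borel) ?f"
    by (simp add: positive_def lim_const)
  moreover have "sigma_algebra UNIV (sets (borel :: (real^'n) measure))"
    using sets.sigma_algebra_axioms[of "borel :: (real^'n) measure"] by simp
  ultimately have "emeasure (digit_measure B D) A = ?f A"
    unfolding digit_measure_def using assms by (intro emeasure_measure_of_sigma)
  then show ?thesis using f[OF assms] by simp
qed

section \<open>Hausdorff measure against counting measure\<close>

text \<open>From here on \<open>s\<close> is the similarity dimension, so that scaling by \<open>B\<^sup>N\<close> multiplies the
  \<open>s\<close>-th power of a diameter by the number \<open>card D ^ N\<close> of tuples.\<close>

context
  fixes s :: real
  assumes s: "s = log \<rho> (real (card D))"
begin

lemma card_digits_pos: "card D > 0"
  using finite_digits zero_digit by (auto simp: card_gt_0_iff)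

lemma dimension_nonneg: "s \<ge> 0"
  using rho card_digits_pos by (simp add: s Suc_le_eq)

lemma scale_power_dimension: "(\<rho> ^ N) powr s = real (card D ^ N)"
proof -
  have "(\<rho> ^ N) powr s = (\<rho> powr s) ^ N"
    using rho by (simp add: powr_powr mult.commute flip: powr_realpow)
  then show ?thesis
    using rho card_digits_pos by (simp add: s)
qed

lemma inv_scale_power_dimension: "(1 / \<rho> ^ N) powr s = 1 / real (card D ^ N)"
  using rho by (simp add: powr_divide scale_power_dimension)

text \<open>The copy of the attractor, contracted by \<open>\<rho>\<^sup>N\<close>, that is addressed by the tuple \<open>l\<close>.
  Different tuples may address overlapping or even equal pieces.\<close>

definition piece :: "nat \<Rightarrow> (nat \<Rightarrow> real^'n) \<Rightarrow> (real^'n) set" where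
  "piece N l = (\<lambda>x. inv (scale N) (x + digit_expansion B N l)) ` attractor"

lemma attractor_eq_pieces: "attractor = (\<Union>l\<in>digits N. piece N l)"
proof -
  have "inv (scale N) ` scale N ` attractor = (\<Union>l\<in>digits N. piece N l)"
    unfolding scale_attractor by (simp add: image_UN image_image piece_def)
  then show ?thesis
    by (simp add: image_inv_f_f[OF inj_scale])
qed

lemma hausdorff_premeasure_pieces:
  assumes "\<delta> > 0" "T \<subseteq> digits N"
  shows "hausdorff_premeasure s \<delta> (\<Union>l\<in>T. piece N l) \<le>
    ennreal (1 / real (card D ^ N)) *
      (of_nat (card T) * hausdorff_premeasure s (\<rho> ^ N * \<delta>) attractor)"
proof -
  have c: "1 / \<rho> ^ N > 0" using rho by simp
  have piece: "hausdorff_premeasure s \<delta> (piece N l) \<le> ennreal (1 / real (card D ^ N)) *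
        hausdorff_premeasure s (\<rho> ^ N * \<delta>) attractor" for l
  proof -
    have "dist (inv (scale N) (x + digit_expansion B N l)) (inv (scale N) (y + digit_expansion B N l)) =
        (1 / \<rho> ^ N) * dist x y" for x y
      by (simp add: dist_inv_scale)
    from hausdorff_premeasure_image_dilation[OF this c, of s "\<rho> ^ N * \<delta>" attractor]
    show ?thesis
      unfolding piece_def inv_scale_power_dimension using rho by simp
  qed
  have "hausdorff_premeasure s \<delta> (\<Union>l\<in>T. piece N l) \<le> (\<Sum>l\<in>T. hausdorff_premeasure s \<delta> (piece N l))"
    using assms finite_subset[OF _ finite_tuples] by (intro hausdorff_premeasure_UN) auto
  also have "\<dots> \<le> (\<Sum>l\<in>T. ennreal (1 / real (card D ^ N)) *
      hausdorff_premeasure s (\<rho> ^ N * \<delta>) attractor)"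
    by (intro sum_mono piece)
  finally show ?thesis
    by (simp add: ac_simps)
qed

text \<open>All size restrictions give the same premeasure of the attractor: replacing a cover of the
  attractor by its contracted copies on the \<open>card D ^ N\<close> pieces preserves the sum of the \<open>s\<close>-th
  powers of the diameters.\<close>

lemma hausdorff_premeasure_attractor_scale:
  assumes "\<delta> > 0"
  shows "hausdorff_premeasure s \<delta> attractor \<le> hausdorff_premeasure s (\<rho> ^ N * \<delta>) attractor"
proof -
  have "ennreal (1 / real (card D ^ N)) * of_nat (card D ^ N) =
      ennreal (1 / real (card D ^ N) * real (card D ^ N))"
    by (simp only: ennreal_of_nat_eq_real_of_nat ennreal_mult zero_le_divide_1_iff of_nat_0_le_iff)
  also have "\<dots> = 1"
    using card_digits_pos by simp
  finally have "ennreal (1 / real (card D ^ N)) * of_nat (card D ^ N) = 1" .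
  then show ?thesis
    using hausdorff_premeasure_pieces[OF assms subset_refl, of N]
    unfolding attractor_eq_pieces[symmetric] card_tuples mult.assoc[symmetric] by simp
qed

lemma hausdorff_premeasure_attractor_eq:
  assumes "\<delta> > 0" "\<delta>' > 0"
  shows "hausdorff_premeasure s \<delta> attractor = hausdorff_premeasure s \<delta>' attractor"
proof -
  have "hausdorff_premeasure s \<delta> attractor \<le> hausdorff_premeasure s \<delta>' attractor"
    if "\<delta> > 0" for \<delta> \<delta>'
  proof -
    obtain N where "\<delta>' / \<delta> < \<rho> ^ N"
      using real_arch_pow[OF rho] by blast
    then have "\<delta>' \<le> \<rho> ^ N * \<delta>"
      using that by (simp add: field_simps)
    then show ?thesis
      by (rule order_trans[OF hausdorff_premeasure_attractor_scale[OF that]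
            hausdorff_premeasure_antimono])
  qed
  then show ?thesis
    using assms by (intro antisym)
qed

lemma hausdorff_measure_attractor:
  assumes "\<delta> > 0"
  shows "hausdorff_measure s attractor = hausdorff_premeasure s \<delta> attractor"
  unfolding hausdorff_measure_def
proof (rule tendsto_Lim)
  have "eventually (\<lambda>x::real. x > 0) (at_right 0)"
    by (simp add: eventually_at_right_less)
  then show "((\<lambda>\<delta>. hausdorff_premeasure s \<delta> attractor) \<longlongrightarrow> hausdorff_premeasure s \<delta> attractor) (at_right 0)"
    by (intro tendsto_eventually) (auto elim!: eventually_mono intro: hausdorff_premeasure_attractor_eq assms)
qed simp

lemma hausdorff_measure_attractor_finite: "hausdorff_measure s attractor < top"
proof -
  have bd: "bounded attractor"
    by (rule compact_imp_bounded[OF compact_attractor])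
  have "hausdorff_measure s attractor \<le> diam_power s attractor"
    using hausdorff_premeasure_le_diam_power[OF bd, of "diameter attractor + 1"] diameter_ge_0[OF bd]
    by (subst hausdorff_measure_attractor[of "diameter attractor + 1"]) auto
  then show ?thesis
    using diam_power_finite by (rule le_less_trans)
qed

text \<open>The pieces addressed by expansions in \<open>U\<close> are covered together by the rescaled Minkowski sum
  of \<open>U\<close> and the attractor, every other piece by a copy of a nearly optimal cover.
  Solving the resulting linear inequality for the Hausdorff measure gives the bound.\<close>

lemma expansion_count_hausdorff_le:
  assumes U: "bounded U" and t: "diameter U + diameter attractor \<le> t" "t > 0"
  shows "expansion_count N U * hausdorff_measure s attractor \<le> ennreal (t powr s)"
proof -
  let ?H = "hausdorff_measure s attractor" and ?m = "real (card D ^ N)"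
  let ?h = "inv (scale N)" and ?W = "{x + y |x y. x \<in> U \<and> y \<in> attractor}"
  let ?good = "{l \<in> digits N. digit_expansion B N l \<in> U}"
  let ?bad = "{l \<in> digits N. digit_expansion B N l \<notin> U}"
  have m: "?m > 0" using card_digits_pos by simp
  have c: "1 / \<rho> ^ N > 0" using rho by simp
  have bdW: "bounded ?W"
    by (rule bounded_subset[OF bounded_sums[OF U compact_imp_bounded[OF compact_attractor]]]) auto
  have diamW: "diameter ?W \<le> t"
    using diameter_sums_le[OF U compact_imp_bounded[OF compact_attractor]] t(1) by simp
  \<comment> \<open>Any size restriction will do; this one admits the large set itself as a member of a cover.\<close>
  define \<delta> where "\<delta> = diameter (?h ` ?W) + 1"
  have \<delta>: "\<delta> > 0" "diameter (?h ` ?W) < \<delta>"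
    using diameter_ge_0[OF diameter_image_dilation(1)[OF dist_inv_scale c bdW]]
    by (auto simp: \<delta>_def)
  have \<delta>': "\<rho> ^ N * \<delta> > 0"
    using \<delta>(1) rho by simp
  have good: "piece N l \<subseteq> ?h ` ?W" if "l \<in> ?good" for l
  proof
    fix x assume "x \<in> piece N l"
    then obtain y where y: "y \<in> attractor" "x = ?h (digit_expansion B N l + y)"
      by (auto simp: piece_def add.commute)
    then show "x \<in> ?h ` ?W" using that by blast
  qed
  have "attractor = (\<Union>l\<in>digits N. piece N l)"
    by (rule attractor_eq_pieces)
  also have "\<dots> \<subseteq> ?h ` ?W \<union> (\<Union>l\<in>?bad. piece N l)"
    using good by blast
  finally have "hausdorff_premeasure s \<delta> attractor \<le>
      hausdorff_premeasure s \<delta> (?h ` ?W) + hausdorff_premeasure s \<delta> (\<Union>l\<in>?bad. piece N l)"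
    by (rule order_trans[OF hausdorff_premeasure_mono hausdorff_premeasure_Un])
  also have "\<dots> \<le> ennreal (1 / ?m) * ennreal (t powr s) +
      ennreal (1 / ?m) * (of_nat (card ?bad) * ?H)"
  proof (rule add_mono)
    have "hausdorff_premeasure s \<delta> (?h ` ?W) \<le> ennreal (1 / ?m) * diam_power s ?W"
      using hausdorff_premeasure_le_diam_power[OF
          diameter_image_dilation(1)[OF dist_inv_scale c bdW] \<delta>(2), of s]
      unfolding diam_power_image_dilation[OF dist_inv_scale c bdW] inv_scale_power_dimension .
    also have "\<dots> \<le> ennreal (1 / ?m) * ennreal (t powr s)"
      by (intro mult_left_mono diam_power_le bdW diamW t(2) dimension_nonneg) simp
    finally show "hausdorff_premeasure s \<delta> (?h ` ?W) \<le> ennreal (1 / ?m) * ennreal (t powr s)" .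
    show "hausdorff_premeasure s \<delta> (\<Union>l\<in>?bad. piece N l) \<le>
        ennreal (1 / ?m) * (of_nat (card ?bad) * ?H)"
      using hausdorff_premeasure_pieces[OF \<delta>(1), of ?bad N]
      by (simp add: hausdorff_measure_attractor[OF \<delta>'])
  qed
  finally have le: "?H \<le> ennreal (1 / ?m) * ennreal (t powr s) +
      ennreal (1 / ?m) * (of_nat (card ?bad) * ?H)"
    by (simp add: hausdorff_measure_attractor[OF \<delta>(1)])
  obtain h where h: "?H = ennreal h" "h \<ge> 0"
    using hausdorff_measure_attractor_finite by (cases ?H) auto
  have "ennreal h \<le> ennreal (1 / ?m * t powr s + 1 / ?m * (real (card ?bad) * h))"
    using le h m by (simp only: ennreal_of_nat_eq_real_of_nat ennreal_mult ennreal_plus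
        mult_nonneg_nonneg powr_ge_zero of_nat_0_le_iff zero_le_divide_1_iff)
  then have "h \<le> 1 / ?m * t powr s + 1 / ?m * (real (card ?bad) * h)"
    using h m by (subst (asm) ennreal_le_iff) auto
  then have "?m * h \<le> ?m * (1 / ?m * t powr s + 1 / ?m * (real (card ?bad) * h))"
    using m by (intro mult_left_mono) auto
  also have "\<dots> = t powr s + real (card ?bad) * h"
    using m by (simp add: distrib_left del: of_nat_power)
  finally have "(?m - real (card ?bad)) * h \<le> t powr s"
    by (simp add: algebra_simps)
  moreover have "card (digits N) = card ?good + card ?bad"
    using finite_tuples by (subst card_Un_disjoint[symmetric]) (auto intro!: arg_cong[where f = card])
  ultimately have "real (card ?good) * h \<le> t powr s"
    unfolding card_tuples by simp
  moreover have "expansion_count N U = of_nat (card ?good)"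
    using finite_tuples by (simp add: expansion_count_def indicator_def Int_def)
  ultimately show ?thesis
    unfolding h(1) using h(2)
    by (simp add: ennreal_of_nat_eq_real_of_nat flip: ennreal_mult)
qed


section \<open>Upper density\<close>

text \<open>The bound does not depend on \<open>N\<close>, so it passes to the limit measure.\<close>

lemma emeasure_hausdorff_le:
  assumes "compact U" "diameter U + diameter attractor \<le> t" "t > 0"
  shows "emeasure (digit_measure B D) U * hausdorff_measure s attractor \<le> ennreal (t powr s)"
  using expansion_count_hausdorff_le[OF compact_imp_bounded[OF assms(1)] assms(2,3)] assms(1)
  by (auto simp: emeasure_digit_measure borel_compact SUP_mult_right_ennreal intro: SUP_least)

text \<open>For large diameters the summand \<open>diameter attractor\<close> in the preceding bound is negligible:
  it contributes the factor \<open>(1 + diameter attractor / r) powr s\<close>, which tends to one.\<close>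

lemma upper_density_le:
  "upper_density s (digit_measure B D) \<le> inverse (hausdorff_measure s attractor)"
proof (cases "hausdorff_measure s attractor = 0")
  case False
  let ?a = "diameter attractor" and ?H = "hausdorff_measure s attractor"
  obtain h where h: "?H = ennreal h" "h > 0"
    using False hausdorff_measure_attractor_finite by (cases ?H) (auto simp: less_le)
  have a: "?a \<ge> 0"
    by (rule diameter_ge_0[OF compact_imp_bounded[OF compact_attractor]])
  let ?g = "\<lambda>r. ennreal ((1 + ?a / r) powr s / h)"
  have bound: "emeasure (digit_measure B D) U / ennreal (diameter U powr s) \<le> ?g r"
    if U: "compact U" "r \<le> diameter U" "r > 0" for U r
  proof (rule divide_le_posI_ennreal)
    let ?d = "diameter U"
    have d: "?d > 0" using U by simp
    then show "ennreal (?d powr s) > 0" by simp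
    have "emeasure (digit_measure B D) U * ?H \<le> ennreal ((?d + ?a) powr s)"
      using d a by (intro emeasure_hausdorff_le U(1)) auto
    then have "(emeasure (digit_measure B D) U * ?H) / ?H \<le> ennreal ((?d + ?a) powr s) / ?H"
      by (rule divide_right_mono_ennreal)
    then have "emeasure (digit_measure B D) U \<le> ennreal ((?d + ?a) powr s / h)"
      unfolding h(1) using h(2) by (simp add: mult_divide_eq_ennreal divide_ennreal)
    also have "?d + ?a = ?d * (1 + ?a / ?d)"
      using d by (simp add: field_simps)
    also have "(?d * (1 + ?a / ?d)) powr s = ?d powr s * (1 + ?a / ?d) powr s"
      by (rule powr_mult)
    also have "ennreal (?d powr s * (1 + ?a / ?d) powr s / h) \<le>
        ennreal (?d powr s * (1 + ?a / r) powr s / h)"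
      using U d a h(2) dimension_nonneg
      by (intro ennreal_leI divide_right_mono mult_left_mono powr_mono2 add_left_mono
          divide_left_mono) auto
    also have "\<dots> = ennreal (?d powr s) * ?g r"
      using h(2) by (simp flip: ennreal_mult)
    finally show "emeasure (digit_measure B D) U \<le> ennreal (?d powr s) * ?g r" .
  qed
  have "upper_density s (digit_measure B D) \<le> Limsup at_top ?g"
    unfolding upper_density_def
    by (intro Limsup_mono always_eventually allI SUP_least) (auto intro: bound)
  also have "Limsup at_top ?g = inverse ?H"
  proof (rule lim_imp_Limsup)
    have "((\<lambda>r. (1 + ?a / r) powr s / h) \<longlongrightarrow> (1 + 0) powr s / h) at_top"
      using h(2) by (intro tendsto_intros tendsto_divide_0 filterlim_at_top_imp_at_infinity filterlim_ident) auto
    then have "(?g \<longlongrightarrow> ennreal (1 / h)) at_top"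
      by (intro tendsto_ennrealI) simp
    then show "(?g \<longlongrightarrow> inverse ?H) at_top"
      unfolding h(1) inverse_ennreal[OF h(2)] by (simp add: inverse_eq_divide)
  qed simp
  finally show ?thesis .
qed simp

text \<open>The fattened set is the Minkowski sum of the closed convex hull with a small ball. The hull does
  not increase the diameter. For \<open>s = 0\<close> both sides count a nonempty set as one, so that the radius
  of the ball is irrelevant.\<close>

lemma compact_convex_fattening:
  fixes U :: "(real^'n) set"
  assumes U: "bounded U" "U \<noteq> {}" and "e > 0"
  obtains V where "compact V" "convex V" "U \<subseteq> interior V" "diameter V > 0"
    "ennreal (diameter V powr s) \<le> diam_power s U + ennreal e"
proof -
  have U0: "diameter U \<ge> 0" by (rule diameter_ge_0[OF U(1)])
  obtain \<epsilon> where \<epsilon>: "\<epsilon> > 0"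
    "ennreal ((diameter U + 2 * \<epsilon>) powr s) \<le> diam_power s U + ennreal e"
  proof (cases "s = 0")
    case True
    then have "ennreal ((diameter U + 2 * 1) powr s) \<le> diam_power s U + ennreal e"
      using U U0 by (simp add: diam_power_def)
    then show ?thesis by (rule that[rotated]) simp
  next
    case False
    then have s0: "s > 0" using dimension_nonneg by simp
    have "((\<lambda>\<epsilon>. (diameter U + 2 * \<epsilon>) powr s) \<longlongrightarrow> (diameter U + 2 * 0) powr s) (at_right 0)"
      using U0 s0
      by (intro tendsto_powr2 tendsto_intros)
        (auto simp: eventually_at_right_less intro: eventually_mono[OF eventually_at_right_less])
    then have "eventually (\<lambda>\<epsilon>. (diameter U + 2 * \<epsilon>) powr s < diameter U powr s + e) (at_right 0)"
      using \<open>e > 0\<close> by (intro order_tendstoD) auto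
    then have "eventually (\<lambda>\<epsilon>. \<epsilon> > 0 \<and> (diameter U + 2 * \<epsilon>) powr s < diameter U powr s + e) (at_right 0)"
      by (intro eventually_conj eventually_at_right_less)
    then obtain \<epsilon> where \<epsilon>: "\<epsilon> > 0" "(diameter U + 2 * \<epsilon>) powr s < diameter U powr s + e"
      using eventually_happens[of _ "at_right (0::real)"] by auto
    then have "ennreal ((diameter U + 2 * \<epsilon>) powr s) \<le> diam_power s U + ennreal e"
      using U False \<open>e > 0\<close> by (simp add: diam_power_def flip: ennreal_plus)
    then show ?thesis using \<epsilon>(1) by (rule that[rotated])
  qed
  define V where "V = {x + y |x y. x \<in> closure (convex hull U) \<and> y \<in> cball 0 \<epsilon>}"
  have cc: "compact (closure (convex hull U))"
    using U(1) by (simp add: bounded_convex_hull)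
  have V: "compact V"
    unfolding V_def by (intro compact_sums cc compact_cball)
  have "convex V"
    unfolding V_def using convex_sums[OF convex_closure[OF convex_convex_hull] convex_cball]
    by (rule back_subst[of convex]) blast
  moreover have UV: "cball u \<epsilon> \<subseteq> V" if "u \<in> U" for u
  proof
    fix x assume "x \<in> cball u \<epsilon>"
    then have "x - u \<in> cball 0 \<epsilon>" by (simp add: dist_norm norm_minus_commute)
    moreover have "u \<in> closure (convex hull U)"
      using that closure_subset hull_subset[of U convex] by blast
    ultimately have "u + (x - u) \<in> V" unfolding V_def by blast
    then show "x \<in> V" by simp
  qed
  have "U \<subseteq> interior V"
    using UV \<epsilon>(1) by (force simp: mem_interior_cball)
  moreover have "diameter V > 0"
  proof -
    obtain u where "u \<in> U" using U(2) by blast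
    then have "diameter (cball u \<epsilon>) \<le> diameter V"
      using UV V by (intro diameter_subset compact_imp_bounded)
    then show ?thesis using \<epsilon>(1) by simp
  qed
  moreover have "ennreal (diameter V powr s) \<le> diam_power s U + ennreal e"
  proof -
    have "diameter V \<le> diameter (closure (convex hull U)) + diameter (cball 0 \<epsilon> :: (real^'n) set)"
      unfolding V_def by (intro diameter_sums_le compact_imp_bounded cc compact_cball)
    also have "\<dots> = diameter U + 2 * \<epsilon>"
      using \<epsilon>(1) U(1)
      by (simp add: diameter_closure diameter_convex_hull bounded_convex_hull)
    finally have "diameter V powr s \<le> (diameter U + 2 * \<epsilon>) powr s"
      using \<open>diameter V > 0\<close> dimension_nonneg by (intro powr_mono2) auto
    then show ?thesis
      using \<epsilon>(2) by (meson ennreal_leI order_trans)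
  qed
  ultimately show ?thesis using V by (intro that)
qed

text \<open>As zero is a digit, every contracted expansion lies in the attractor, hence in a member of any
  cover.\<close>

lemma expansion_count_scaled_cover:
  assumes "attractor \<subseteq> (\<Union>i\<in>I. V i)" "finite I"
  shows "of_nat (card D ^ N) \<le> (\<Sum>i\<in>I. expansion_count N (scale N ` V i))"
proof -
  have "(1::ennreal) \<le> (\<Sum>i\<in>I. indicator (scale N ` V i) (digit_expansion B N l))"
    if l: "l \<in> digits N" for l
  proof -
    have "inv (scale N) (digit_expansion B N l) \<in> attractor"
      using scaled_expansions_attractor l unfolding scaled_expansions_def by blast
    then obtain i where i: "i \<in> I" "inv (scale N) (digit_expansion B N l) \<in> V i"
      using assms(1) by blast
    then have "digit_expansion B N l \<in> scale N ` V i"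
      using surj_f_inv_f[OF surj_scale] by (metis imageI)
    then have "(1::ennreal) = indicator (scale N ` V i) (digit_expansion B N l)"
      by simp
    also have "\<dots> \<le> (\<Sum>i\<in>I. indicator (scale N ` V i) (digit_expansion B N l))"
      using assms(2) i(1) by (intro member_le_sum) auto
    finally show ?thesis .
  qed
  then have "(\<Sum>l\<in>digits N. (1::ennreal)) \<le>
      (\<Sum>l\<in>digits N. \<Sum>i\<in>I. indicator (scale N ` V i) (digit_expansion B N l))"
    by (rule sum_mono)
  then show ?thesis
    unfolding expansion_count_def by (subst sum.swap) (simp add: card_tuples)
qed

text \<open>A density bound for sets of large diameter controls covers by arbitrarily small sets: the
  members of a finite cover are expanded by \<open>B\<^sup>N\<close> until all of them are large.\<close>

lemma density_bound_compact_cover: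
  assumes C: "\<And>U. compact U \<Longrightarrow> convex U \<Longrightarrow> r \<le> diameter U \<Longrightarrow>
      emeasure (digit_measure B D) U \<le> C * ennreal (diameter U powr s)"
    and V: "\<And>i. i \<in> I \<Longrightarrow> compact (V i) \<and> convex (V i) \<and> diameter (V i) > 0"
    and I: "finite I" "attractor \<subseteq> (\<Union>i\<in>I. V i)"
  shows "1 \<le> C * (\<Sum>i\<in>I. ennreal (diameter (V i) powr s))"
proof -
  have "\<exists>N. \<forall>n\<ge>N. r \<le> \<rho> ^ n * diameter (V i)" if "i \<in> I" for i
  proof -
    have d: "diameter (V i) > 0" using V[OF that] by simp
    obtain N where N: "r / diameter (V i) < \<rho> ^ N"
      using real_arch_pow[OF rho] by blast
    have "r \<le> \<rho> ^ n * diameter (V i)" if "n \<ge> N" for n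
    proof -
      have "\<rho> ^ N \<le> \<rho> ^ n" using rho that by (intro power_increasing) auto
      with N have "r / diameter (V i) \<le> \<rho> ^ n" by linarith
      then show ?thesis using d by (simp add: field_simps)
    qed
    then show ?thesis by blast
  qed
  then have "\<forall>i\<in>I. eventually (\<lambda>n. r \<le> \<rho> ^ n * diameter (V i)) sequentially"
    by (simp add: eventually_sequentially)
  then have "eventually (\<lambda>n. \<forall>i\<in>I. r \<le> \<rho> ^ n * diameter (V i)) sequentially"
    using I(1) by (simp add: eventually_ball_finite)
  then obtain N where N: "\<And>i. i \<in> I \<Longrightarrow> r \<le> \<rho> ^ N * diameter (V i)"
    by (auto simp: eventually_sequentially)
  let ?m = "of_nat (card D ^ N) :: ennreal"
  have rN: "\<rho> ^ N > 0" using rho by simp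
  have diam: "diameter (scale N ` V i) = \<rho> ^ N * diameter (V i)" if "i \<in> I" for i
    using V[OF that] by (intro diameter_image_dilation(2)[OF dist_scale rN] compact_imp_bounded) simp
  have "?m \<le> (\<Sum>i\<in>I. expansion_count N (scale N ` V i))"
    by (rule expansion_count_scaled_cover[OF I(2,1)])
  also have "\<dots> \<le> (\<Sum>i\<in>I. ?m * (C * ennreal (diameter (V i) powr s)))"
  proof (rule sum_mono)
    fix i assume i: "i \<in> I"
    have comp: "compact (scale N ` V i)"
      using V[OF i] linear_continuous_on[OF linear_conv_bounded_linear[THEN iffD1, OF linear_scale]]
      by (intro compact_continuous_image) auto
    have "expansion_count N (scale N ` V i) \<le> emeasure (digit_measure B D) (scale N ` V i)"
      unfolding emeasure_digit_measure[OF borel_compact[OF comp]] by (rule SUP_upper) simp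
    also have "\<dots> \<le> C * ennreal (diameter (scale N ` V i) powr s)"
      using V[OF i] N[OF i] diam[OF i]
      by (intro C comp convex_linear_image linear_scale) auto
    also have "diameter (scale N ` V i) powr s = real (card D ^ N) * diameter (V i) powr s"
      using V[OF i] rN by (simp add: diam[OF i] powr_mult scale_power_dimension)
    also have "C * ennreal \<dots> = ?m * (C * ennreal (diameter (V i) powr s))"
      by (simp only: ennreal_mult of_nat_0_le_iff powr_ge_zero
          ennreal_of_nat_eq_real_of_nat mult.left_commute)
    finally show "expansion_count N (scale N ` V i) \<le> ?m * (C * ennreal (diameter (V i) powr s))" .
  qed
  also have "\<dots> = ?m * (C * (\<Sum>i\<in>I. ennreal (diameter (V i) powr s)))"
    by (simp only: sum_distrib_left)
  finally have "?m * 1 \<le> ?m * (C * (\<Sum>i\<in>I. ennreal (diameter (V i) powr s)))"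
    by simp
  moreover have "?m \<noteq> 0" "?m < top"
    using card_digits_pos by (simp_all add: of_nat_less_top del: of_nat_power)
  ultimately show ?thesis
    by (subst (asm) ennreal_mult_le_mult_iff) (auto simp: less_top)
qed

lemma density_bound_hausdorff:
  assumes C: "\<And>U. compact U \<Longrightarrow> convex U \<Longrightarrow> r \<le> diameter U \<Longrightarrow>
      emeasure (digit_measure B D) U \<le> C * ennreal (diameter U powr s)"
    and "C < top"
  shows "inverse C \<le> hausdorff_measure s attractor"
proof -
  have "1 \<le> C * (\<Sum>i. diam_power s (U i))"
    if U: "attractor \<subseteq> (\<Union>i. U i)" "\<And>i. bounded (U i)" for U :: "nat \<Rightarrow> _"
  proof -
    have "1 \<le> C * (\<Sum>i. diam_power s (U i)) + C * ennreal e" if e: "e > 0" for e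
    proof -
      have "\<exists>V. compact V \<and> convex V \<and> U i \<subseteq> interior V \<and> diameter V > 0 \<and>
          ennreal (diameter V powr s) \<le> diam_power s (U i) + ennreal (e * (1 / 2) ^ Suc i)"
        if "U i \<noteq> {}" for i
        using compact_convex_fattening[OF U(2) that, of "e * (1 / 2) ^ Suc i"] e
        by (metis mult_pos_pos zero_less_power half_gt_zero zero_less_one)
      then obtain V where V: "\<And>i. U i \<noteq> {} \<Longrightarrow> compact (V i) \<and> convex (V i) \<and>
          U i \<subseteq> interior (V i) \<and> diameter (V i) > 0 \<and>
          ennreal (diameter (V i) powr s) \<le> diam_power s (U i) + ennreal (e * (1 / 2) ^ Suc i)"
        by metis
      have "attractor \<subseteq> (\<Union>i\<in>{i. U i \<noteq> {}}. interior (V i))"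
        using U(1) V by blast
      then obtain I where I: "I \<subseteq> {i. U i \<noteq> {}}" "finite I" "attractor \<subseteq> (\<Union>i\<in>I. interior (V i))"
        by (rule compactE_image[OF compact_attractor, rotated]) auto
      have "1 \<le> C * (\<Sum>i\<in>I. ennreal (diameter (V i) powr s))"
        using I V interior_subset by (intro density_bound_compact_cover[OF C]) blast+
      also have "\<dots> \<le> C * (\<Sum>i\<in>I. diam_power s (U i) + ennreal (e * (1 / 2) ^ Suc i))"
        using I(1) V by (intro mult_left_mono sum_mono) auto
      also have "\<dots> \<le> C * (\<Sum>i. diam_power s (U i) + ennreal (e * (1 / 2) ^ Suc i))"
        using I(2) by (intro mult_left_mono sum_le_suminf) auto
      also have "\<dots> = C * (\<Sum>i. diam_power s (U i)) + C * (\<Sum>i. ennreal (e * (1 / 2) ^ Suc i))"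
        by (subst suminf_add[symmetric]) (auto simp: distrib_left)
      also have "(\<Sum>i. ennreal (e * (1 / 2) ^ Suc i)) = ennreal e"
        using e sums_mult[OF power_half_series, of e] by (intro suminf_ennreal_eq) auto
      finally show ?thesis .
    qed
    note bound = this
    \<comment> \<open>Dividing by \<open>c + 1\<close> also covers the case that \<open>C\<close> is zero.\<close>
    obtain c where c: "C = ennreal c" "c \<ge> 0"
      using \<open>C < top\<close> by (cases C) auto
    show ?thesis
    proof (rule ennreal_le_epsilon)
      fix e :: real assume e: "0 < e"
      have "C * ennreal (e / (c + 1)) \<le> ennreal e"
        unfolding c(1) using c(2) e
        by (subst ennreal_mult[symmetric]) (auto simp: field_simps intro!: ennreal_leI)
      with bound[of "e / (c + 1)"] show "1 \<le> C * (\<Sum>i. diam_power s (U i)) + ennreal e"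
        using c(2) e by (auto intro: order_trans add_left_mono)
    qed
  qed
  note cover = this
  have "C \<noteq> 0"
    using cover[of "\<lambda>_. attractor"] compact_imp_bounded[OF compact_attractor] by auto
  then have "1 / C \<le> (\<Sum>i. diam_power s (U i))"
    if "attractor \<subseteq> (\<Union>i. U i)" "\<And>i. bounded (U i)" for U :: "nat \<Rightarrow> _"
    using cover[OF that] by (intro divide_le_posI_ennreal) (auto simp: zero_less_iff_neq_zero)
  then show ?thesis
    unfolding hausdorff_measure_attractor[OF zero_less_one] hausdorff_premeasure_def
    by (intro INF_greatest) (auto simp: divide_ennreal_def)
qed

lemma hausdorff_measure_ge:
  "inverse (upper_density s (digit_measure B D)) \<le> hausdorff_measure s attractor"
proof (rule ccontr)
  let ?E = "upper_density s (digit_measure B D)" and ?H = "hausdorff_measure s attractor"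
  assume "\<not> ?thesis"
  then have "?E < inverse ?H"
    by (simp add: ennreal_inverse_le_commute[of ?E] not_le)
  then obtain C where C: "?E < C" "C < inverse ?H"
    using dense by blast
  have "eventually (\<lambda>r::real. (SUP U\<in>{U. compact U \<and> convex U \<and> diameter U \<ge> r \<and> r > 0}.
      emeasure (digit_measure B D) U / ennreal (diameter U powr s)) < C) at_top"
    using C(1) unfolding upper_density_def by (rule Limsup_lessD)
  then have "eventually (\<lambda>r::real. r > 0 \<and> (SUP U\<in>{U. compact U \<and> convex U \<and> diameter U \<ge> r \<and> r > 0}.
      emeasure (digit_measure B D) U / ennreal (diameter U powr s)) < C) at_top"
    by (intro eventually_conj eventually_gt_at_top)
  from eventually_happens'[OF trivial_limit_at_top_linorder this]
  obtain r where r: "r > 0" "(SUP U\<in>{U. compact U \<and> convex U \<and> diameter U \<ge> r \<and> r > 0}.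
      emeasure (digit_measure B D) U / ennreal (diameter U powr s)) < C"
    by (elim exE conjE) (rule that)
  have "emeasure (digit_measure B D) U \<le> C * ennreal (diameter U powr s)"
    if U: "compact U" "convex U" "r \<le> diameter U" for U
  proof -
    have "emeasure (digit_measure B D) U / ennreal (diameter U powr s) < C"
      using U r(1) by (intro le_less_trans[OF SUP_upper r(2)]) auto
    then show ?thesis
      using U(3) r(1) by (subst (asm) divide_less_ennreal) auto
  qed
  then have "inverse C \<le> ?H"
    using less_le_trans[OF C(2) top_greatest] by (rule density_bound_hausdorff)
  then show False
    using C(2) by (simp add: ennreal_inverse_le_commute[of C])
qed

lemma hausdorff_measure_eq_inverse_upper_density:
  "hausdorff_measure s (self_similar_set B D) = inverse (upper_density s (digit_measure B D))"
proof (rule antisym)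
  show "hausdorff_measure s (self_similar_set B D) \<le> inverse (upper_density s (digit_measure B D))"
    unfolding self_similar_set_eq ennreal_le_inverse_commute[of "hausdorff_measure s attractor"]
    by (rule upper_density_le)
qed (simp add: self_similar_set_eq hausdorff_measure_ge)

end
end

lemma similarity_digitsI:
  fixes B :: "real^'n^'n"
  assumes "\<rho> > 1" "similarity_matrix \<rho> B" "finite D" "0 \<in> D"
  shows "similarity_digits B D \<rho>"
proof
  obtain R where R: "orthogonal_matrix R" "B = \<rho> *\<^sub>R R"
    using assms(2) unfolding similarity_matrix_def by blast
  have "orthogonal_transformation ((*v) R)"
    using R(1) by (simp add: orthogonal_transformation_matrix)
  then show "norm (B *v x) = \<rho> * norm x" for x
    using assms(1) by (simp add: R(2) scaleR_matrix_vector_assoc[symmetric] orthogonal_transformation)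
qed (use assms in auto)

theorem theorem1p4:
  fixes B :: "real^'n^'n" and D :: "(real^'n) set" and \<rho> s :: real
  assumes "\<rho> > 1"
    and "similarity_matrix \<rho> B"
    and "finite D"
    and "0 \<in> D"
    and "real (card D) \<le> \<bar>det B\<bar>"
    and "s = log \<rho> (real (card D))"
  shows "hausdorff_measure s (self_similar_set B D) = inverse (upper_density s (digit_measure B D))"
proof -
  interpret similarity_digits B D \<rho>
    by (rule similarity_digitsI[OF assms(1-4)])
  show ?thesis
    by (rule hausdorff_measure_eq_inverse_upper_density[OF assms(6)])
qed

end
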